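(* Let $\mathcal R=\langle R\mid\nu,\mu\rangle$ be an $(m_r,n_r)$-ring, with totally associative addition $\nu$, and let $\mathsf G=\langle G\mid\mu_{\mathsf G}\rangle$ be an $n_g$-ary group. Let $\ell_m>1$, let $M=\ell_m(m_r-1)+1$, and suppose $M>m_r$. Let $S$ be the set of formal sums with coefficients in $R$ and basis $G$, and let $\boldsymbol\nu:S^M\to S$ be the addition of the polyadic group ring of polyadic power $\ell_m$, $$\boldsymbol\nu\Big[\sum_{g} r_g(1)\bullet g,\ \ldots,\ \sum_g r_g(M)\bullet g\Big]=\sum_g \nu^{\circ \ell_m}\big[r_g(1),\ldots,r_g(M)\big]\bullet g .$$ Then $\boldsymbol\nu$ is totally associative.
   Context: All arities are integers $\ge 2$. An $n$-ary operation $\mu:X^n\to X$ is totally associative if, for all $x_1,\dots,x_{2n-1}\in X$, the value $\mu[x_1,\dots,x_{i-1},\mu[x_i,\dots,x_{i+n-1}],x_{i+n},\dots,x_{2n-1}]$ does not depend on $i\in\{1,\dots,n\}$; then $\langle X\mid\mu\rangle$ is an $n$-ary semigroup. For $\ell\ge1$, $\mu^{\circ\ell}$ denotes the $\ell$-fold composition of $\mu$ with itself (it contains $\ell$ copies of $\mu$; by associativity the bracketing is irrelevant); it takes exactly $\ell(n-1)+1$ arguments. An $n$-ary group is an $n$-ary semigroup in which (for $n\ge3$) every $x$ has a querelement $\bar x$, i.e. $\mu[\bar x,x,\dots,x]=x$ with $\bar x$ in any of the $n$ positions; for $n=2$ it is an ordinary group. An $(m_r,n_r)$-ring $\langle R\mid\nu,\mu\rangle$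 is a set with an $m_r$-ary addition $\nu$ making $R$ a commutative $m_r$-ary group, and an $n_r$-ary multiplication $\mu$ making $R$ an $n_r$-ary semigroup, such that $\mu$ distributes over $\nu$ in each of its $n_r$ arguments. A polyadic zero of $\mathcal R$, if it exists, is an element $z_R\in R$ with $\nu[r,z_R,\dots,z_R]=r$ for all $r$ and with $\mu[r_1,\dots,r_{n_r}]=z_R$ whenever some $r_i=z_R$. Formal sums: an element of $S$ is a formal sum $\sum_{g\in G}r_g\bullet g$, i.e. a family $(r_g)_{g\in G}$ of elements of $R$. If $\mathcal R$ has a polyadic zero $z_R$, all but finitely many $r_g$ are required to equal $z_R$ (and such terms may be omitted); if $\mathcal R$ has no polyadic zero, $G$ is finite and all families are allowed. *)

theory Defs
  imports "HOL-Algebra.Group" "HOL-Library.FuncSet" "HOL-Library.Multiset"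
begin

text \<open>An \<open>n\<close>-ary operation on \<open>X\<close> is a function on lists, of which only the values on lists of
  length \<open>n\<close> with entries in \<open>X\<close> are relevant.\<close>

definition tuples :: "nat \<Rightarrow> 'a set \<Rightarrow> 'a list set" where
  "tuples n X = {xs. length xs = n \<and> set xs \<subseteq> X}"

definition nary_operation :: "nat \<Rightarrow> 'a set \<Rightarrow> ('a list \<Rightarrow> 'a) \<Rightarrow> bool" where
  "nary_operation n X \<mu> \<longleftrightarrow> \<mu> \<in> tuples n X \<rightarrow> X"

text \<open>The inner operation is applied to the \<open>n\<close> entries following the first \<open>i\<close> ones, so the
  positions \<open>1, \<dots>, n\<close> of the inner operation correspond to \<open>i = 0, \<dots>, n - 1\<close>.\<close>

definition insert_op :: "nat \<Rightarrow> ('a list \<Rightarrow> 'a) \<Rightarrow> nat \<Rightarrow> 'a list \<Rightarrow> 'a" where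
  "insert_op n \<mu> i xs = \<mu> (take i xs @ [\<mu> (take n (drop i xs))] @ drop (i + n) xs)"

definition totally_associative :: "nat \<Rightarrow> 'a set \<Rightarrow> ('a list \<Rightarrow> 'a) \<Rightarrow> bool" where
  "totally_associative n X \<mu> \<longleftrightarrow>
     (\<forall>xs \<in> tuples (2 * n - 1) X. \<forall>i<n. \<forall>j<n. insert_op n \<mu> i xs = insert_op n \<mu> j xs)"

definition nary_semigroup :: "nat \<Rightarrow> 'a set \<Rightarrow> ('a list \<Rightarrow> 'a) \<Rightarrow> bool" where
  "nary_semigroup n X \<mu> \<longleftrightarrow> 2 \<le> n \<and> nary_operation n X \<mu> \<and> totally_associative n X \<mu>"

text \<open>The \<open>l\<close>-fold composition, bracketed to the left:
  \<open>\<mu>[\<dots>\<mu>[\<mu>[x\<^sub>1, \<dots>, x\<^sub>n], x\<^bsub>n+1\<^esub>, \<dots>, x\<^bsub>2n-1\<^esub>], \<dots>]\<close>. The case \<open>l = 0\<close> is the identity of one argument,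
  so that \<open>l = 1\<close> gives \<open>\<mu>\<close> itself.\<close>

primrec fold_comp :: "nat \<Rightarrow> ('a list \<Rightarrow> 'a) \<Rightarrow> nat \<Rightarrow> 'a list \<Rightarrow> 'a" where
  "fold_comp n \<mu> 0 xs = hd xs"
| "fold_comp n \<mu> (Suc l) xs = fold_comp n \<mu> l (\<mu> (take n xs) # drop n xs)"

definition querelement :: "nat \<Rightarrow> 'a set \<Rightarrow> ('a list \<Rightarrow> 'a) \<Rightarrow> 'a \<Rightarrow> 'a \<Rightarrow> bool" where
  "querelement n X \<mu> x q \<longleftrightarrow> q \<in> X \<and> (\<forall>i<n. \<mu> ((replicate n x)[i := q]) = x)"

definition nary_group :: "nat \<Rightarrow> 'a set \<Rightarrow> ('a list \<Rightarrow> 'a) \<Rightarrow> bool" where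
  "nary_group n X \<mu> \<longleftrightarrow> nary_semigroup n X \<mu> \<and>
     (if n = 2
      then \<exists>e. Group.group \<lparr>carrier = X, monoid.mult = (\<lambda>x y. \<mu> [x, y]), one = e\<rparr>
      else \<forall>x\<in>X. \<exists>q. querelement n X \<mu> x q)"

definition commutative_op :: "nat \<Rightarrow> 'a set \<Rightarrow> ('a list \<Rightarrow> 'a) \<Rightarrow> bool" where
  "commutative_op n X \<mu> \<longleftrightarrow>
     (\<forall>xs \<in> tuples n X. \<forall>ys \<in> tuples n X. mset xs = mset ys \<longrightarrow> \<mu> xs = \<mu> ys)"

definition distributes_over ::
    "nat \<Rightarrow> nat \<Rightarrow> 'a set \<Rightarrow> ('a list \<Rightarrow> 'a) \<Rightarrow> ('a list \<Rightarrow> 'a) \<Rightarrow> bool" where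
  "distributes_over m n X \<nu> \<mu> \<longleftrightarrow>
     (\<forall>xs \<in> tuples n X. \<forall>ys \<in> tuples m X. \<forall>i<n.
        \<mu> (xs[i := \<nu> ys]) = \<nu> (map (\<lambda>y. \<mu> (xs[i := y])) ys))"

definition polyadic_ring ::
    "nat \<Rightarrow> nat \<Rightarrow> 'a set \<Rightarrow> ('a list \<Rightarrow> 'a) \<Rightarrow> ('a list \<Rightarrow> 'a) \<Rightarrow> bool" where
  "polyadic_ring m n R \<nu> \<mu> \<longleftrightarrow>
     nary_group m R \<nu> \<and> commutative_op m R \<nu> \<and> nary_semigroup n R \<mu> \<and> distributes_over m n R \<nu> \<mu>"

definition polyadic_zero ::
    "nat \<Rightarrow> nat \<Rightarrow> 'a set \<Rightarrow> ('a list \<Rightarrow> 'a) \<Rightarrow> ('a list \<Rightarrow> 'a) \<Rightarrow> 'a \<Rightarrow> bool" where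
  "polyadic_zero m n R \<nu> \<mu> z \<longleftrightarrow> z \<in> R \<and>
     (\<forall>r\<in>R. \<nu> (r # replicate (m - 1) z) = r) \<and>
     (\<forall>rs \<in> tuples n R. z \<in> set rs \<longrightarrow> \<mu> rs = z)"

text \<open>A polyadic zero is unique for \<open>n \<ge> 2\<close>, since a product containing two zeros equals both of
  them; hence the quantifier over \<open>z\<close> refers to the zero of \<open>R\<close>, and it is vacuous if there is
  none. In that case all families are formal sums, and \<open>G\<close> is to be assumed finite.\<close>

definition formal_sums ::
    "nat \<Rightarrow> nat \<Rightarrow> 'r set \<Rightarrow> ('r list \<Rightarrow> 'r) \<Rightarrow> ('r list \<Rightarrow> 'r) \<Rightarrow> 'g set \<Rightarrow> ('g \<Rightarrow> 'r) set" where
  "formal_sums m n R \<nu> \<mu> G =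
     {s \<in> G \<rightarrow>\<^sub>E R. \<forall>z. polyadic_zero m n R \<nu> \<mu> z \<longrightarrow> finite {g \<in> G. s g \<noteq> z}}"

definition group_ring_add ::
    "nat \<Rightarrow> ('r list \<Rightarrow> 'r) \<Rightarrow> nat \<Rightarrow> 'g set \<Rightarrow> ('g \<Rightarrow> 'r) list \<Rightarrow> ('g \<Rightarrow> 'r)" where
  "group_ring_add m \<nu> l G ss = (\<lambda>g\<in>G. fold_comp m \<nu> l (map (\<lambda>s. s g) ss))"

end

theory Submission imports Defs begin

text \<open>
  The addition of formal sums acts on each coefficient separately, and on a coefficient it is the
  \<open>l\<close>-fold composition of the addition of \<open>R\<close>. So the claim splits into a statement about one
  \<open>n\<close>-ary semigroup \<open>\<langle>X | \<mu>\<rangle>\<close>, namely that its iterates are again semigroup operations, and a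
  pointwise lifting.

  For the first part, the left-bracketed composition is compared with bracketings of other shapes.
  Total associativity moves one inner \<open>\<mu>\<close> from the front to any place, so in a composition of
  \<open>k + 1\<close> copies an arbitrary window of \<open>n\<close> consecutive arguments may be multiplied first
  (\<open>fold_comp_contract_window\<close>). Contracting windows repeatedly inside a block of \<open>l (n - 1) + 1\<close>
  arguments shows that the whole block may be multiplied first
  (\<open>fold_comp_contract_block\<close>). Hence for the \<open>l\<close>-fold composition, wherever the inner composition
  is placed among the arguments of the outer one, the value is the \<open>2 l\<close>-fold composition of all
  arguments, which does not depend on the place.

  For the lifting, what remains is closure: the sum of formal sums is a formal sum because a
  polyadic zero is an idempotent of the addition, so that the support of a sum lies in the union
  of the finitely many supports of its summands.
\<close>

section \<open>Iterates of a totally associative operation\<close>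

lemma nary_semigroup_closed:
  assumes "nary_semigroup n X \<mu>" "length xs = n" "set xs \<subseteq> X"
  shows "\<mu> xs \<in> X"
  using assms by (auto simp: nary_semigroup_def nary_operation_def tuples_def)

text \<open>The instance of total associativity that the iteration needs, phrased with appended lists:
  compositions built by \<open>fold_comp\<close> always have their inner product at the front.\<close>

lemma nary_semigroup_assoc_front:
  assumes "nary_semigroup n X \<mu>" "length (ps @ ys @ qs) = 2 * n - 1" "length ys = n"
    and "set (ps @ ys @ qs) \<subseteq> X"
  shows "\<mu> (ps @ [\<mu> ys] @ qs)
       = \<mu> (\<mu> (take n (ps @ ys @ qs)) # drop n (ps @ ys @ qs))"
proof -
  let ?xs = "ps @ ys @ qs"
  have "2 \<le> n" "totally_associative n X \<mu>"
    using assms(1) by (auto simp: nary_semigroup_def)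
  moreover have "?xs \<in> tuples (2 * n - 1) X" using assms by (simp add: tuples_def)
  moreover have "length ps < n" "0 < n" using assms(2,3) \<open>2 \<le> n\<close> by simp_all
  ultimately have "insert_op n \<mu> (length ps) ?xs = insert_op n \<mu> 0 ?xs"
    unfolding totally_associative_def by blast
  thus ?thesis using assms(3) by (simp add: insert_op_def)
qed

text \<open>The left-bracketed composition contracts its first \<open>n\<close> arguments. A window that lies behind
  them is untouched by this step and is left to the induction hypothesis; a window that overlaps
  them lies within the first \<open>2 n - 1\<close> arguments, so total associativity applies to these.\<close>

lemma fold_comp_contract_window:
  assumes sg: "nary_semigroup n X \<mu>"
    and "set (ps @ ys @ qs) \<subseteq> X" "length ys = n" "length (ps @ qs) = k * (n - 1)"
  shows "fold_comp n \<mu> (Suc k) (ps @ ys @ qs) = fold_comp n \<mu> k (ps @ [\<mu> ys] @ qs)"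
  using assms(2-)
proof (induction k arbitrary: ps)
  case 0
  then show ?case by simp
next
  case (Suc k)
  have n: "2 \<le> n" using sg by (simp add: nary_semigroup_def)
  show ?case
  proof (cases "n \<le> length ps")
    case True
    let ?ps = "\<mu> (take n ps) # drop n ps"
    have "set (take n ps) \<subseteq> X" using Suc.prems(1) set_take_subset[of n ps] by auto
    then have "\<mu> (take n ps) \<in> X" using True by (intro nary_semigroup_closed[OF sg]) auto
    then have "set (?ps @ ys @ qs) \<subseteq> X"
      using Suc.prems(1) set_drop_subset[of n ps] by auto
    moreover have "length (?ps @ qs) = k * (n - 1)" using Suc.prems(3) True n by simp
    ultimately have "fold_comp n \<mu> (Suc k) (?ps @ ys @ qs) = fold_comp n \<mu> k (?ps @ [\<mu> ys] @ qs)"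
      using Suc.IH Suc.prems(2) by blast
    then show ?thesis using True by simp
  next
    case False
    define j where "j = n - 1 - length ps"
    \<comment> \<open>\<open>us\<close> completes the arguments up to the end of the window to \<open>2 n - 1\<close> arguments.\<close>
    define us vs where "us = take j qs" and "vs = drop j qs"
    have qs: "qs = us @ vs" by (simp add: us_def vs_def)
    have "length us = j" using Suc.prems(3) False n by (simp add: us_def j_def)
    then have len: "length (ps @ ys @ us) = 2 * n - 1"
      using False Suc.prems(2) n by (simp add: j_def)
    let ?w = "ps @ ys @ us"
    have "set ?w \<subseteq> X" using Suc.prems(1) qs by auto
    then have eq: "\<mu> (ps @ [\<mu> ys] @ us) = \<mu> (\<mu> (take n ?w) # drop n ?w)"
      by (rule nary_semigroup_assoc_front[OF sg len Suc.prems(2)])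
    have front: "fold_comp n \<mu> (Suc l) (as @ bs) = fold_comp n \<mu> l (\<mu> as # bs)"
      if "length as = n" for l as bs using that by simp
    have len_d: "length (\<mu> (take n ?w) # drop n ?w) = n" using len n by simp
    have "fold_comp n \<mu> (Suc (Suc k)) (?w @ vs)
        = fold_comp n \<mu> (Suc (Suc k)) (take n ?w @ drop n ?w @ vs)"
      by (metis append.assoc append_take_drop_id)
    also have "\<dots> = fold_comp n \<mu> (Suc k) ((\<mu> (take n ?w) # drop n ?w) @ vs)"
      by (subst front) (use len n in auto)
    also have "\<dots> = fold_comp n \<mu> k (\<mu> (ps @ [\<mu> ys] @ us) # vs)"
      by (subst front[OF len_d]) (simp only: eq)
    also have "\<dots> = fold_comp n \<mu> (Suc k) ((ps @ [\<mu> ys] @ us) @ vs)"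
      by (subst front) (use len Suc.prems(2) n in auto)
    finally show ?thesis by (simp add: qs)
  qed
qed

text \<open>Contracting the first window of the block shortens it to a block for \<open>l\<close> copies, which by
  induction collapses to one argument; the same contraction is the first step in evaluating the
  block on its own.\<close>

lemma fold_comp_contract_block:
  assumes sg: "nary_semigroup n X \<mu>"
    and "set (ps @ ys @ qs) \<subseteq> X" "length ys = l * (n - 1) + 1" "length (ps @ qs) = k * (n - 1)"
  shows "fold_comp n \<mu> (l + k) (ps @ ys @ qs) = fold_comp n \<mu> k (ps @ [fold_comp n \<mu> l ys] @ qs)"
  using assms(2-)
proof (induction l arbitrary: ys)
  case 0
  then obtain y where "ys = [y]" by (metis One_nat_def add_0 length_0_conv length_Suc_conv mult_0)
  then show ?case by simp
next
  case (Suc l)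
  have n: "2 \<le> n" using sg by (simp add: nary_semigroup_def)
  define as bs where "as = take n ys" and "bs = drop n ys"
  have ys: "ys = as @ bs" by (simp add: as_def bs_def)
  have as: "length as = n" using Suc.prems(2) n by (simp add: as_def)
  have bs: "length bs = l * (n - 1)" using Suc.prems(2) n as by (simp add: ys)
  have "\<mu> as \<in> X" using Suc.prems(1) as by (intro nary_semigroup_closed[OF sg]) (auto simp: ys)
  then have in_X: "set (ps @ (\<mu> as # bs) @ qs) \<subseteq> X" using Suc.prems(1) by (auto simp: ys)
  have "fold_comp n \<mu> (Suc (l + k)) (ps @ as @ (bs @ qs))
      = fold_comp n \<mu> (l + k) (ps @ [\<mu> as] @ (bs @ qs))"
    by (rule fold_comp_contract_window[OF sg])
       (use Suc.prems as bs in \<open>simp_all add: ys add_mult_distrib\<close>)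
  also have "\<dots> = fold_comp n \<mu> k (ps @ [fold_comp n \<mu> l (\<mu> as # bs)] @ qs)"
    using Suc.IH[of "\<mu> as # bs"] in_X bs Suc.prems(3) by simp
  finally show ?case using as by (simp add: ys)
qed

lemma fold_comp_closed:
  assumes sg: "nary_semigroup n X \<mu>" and "set xs \<subseteq> X" "length xs = l * (n - 1) + 1"
  shows "fold_comp n \<mu> l xs \<in> X"
  using assms(2-)
proof (induction l arbitrary: xs)
  case 0
  then show ?case by (auto simp: length_Suc_conv)
next
  case (Suc l)
  have n: "2 \<le> n" using sg by (simp add: nary_semigroup_def)
  have "set (take n xs) \<subseteq> X" using Suc.prems(1) set_take_subset[of n xs] by auto
  then have "\<mu> (take n xs) \<in> X"
    using Suc.prems(2) n by (intro nary_semigroup_closed[OF sg]) auto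
  then show ?case
    using Suc.prems n set_drop_subset[of n xs] by (auto intro!: Suc.IH)
qed

lemma fold_comp_totally_associative:
  assumes sg: "nary_semigroup n X \<mu>" and M: "M = l * (n - 1) + 1"
  shows "totally_associative M X (fold_comp n \<mu> l)"
proof -
  have "insert_op M (fold_comp n \<mu> l) i xs = fold_comp n \<mu> (l + l) xs"
    if "xs \<in> tuples (2 * M - 1) X" "i < M" for xs i
  proof -
    let ?ps = "take i xs" and ?ys = "take M (drop i xs)" and ?qs = "drop (i + M) xs"
    have xs: "?ps @ ?ys @ ?qs = xs"
      by (metis add.commute append_take_drop_id drop_drop)
    have len: "length xs = 2 * M - 1" and X: "set xs \<subseteq> X" using that by (auto simp: tuples_def)
    have "fold_comp n \<mu> (l + l) (?ps @ ?ys @ ?qs)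
        = fold_comp n \<mu> l (?ps @ [fold_comp n \<mu> l ?ys] @ ?qs)"
    proof (rule fold_comp_contract_block[OF sg])
      show "set (?ps @ ?ys @ ?qs) \<subseteq> X" using X by (simp only: xs)
    qed (use len \<open>i < M\<close> M in auto)
    then show ?thesis unfolding xs by (simp add: insert_op_def)
  qed
  then show ?thesis unfolding totally_associative_def by simp
qed

section \<open>Lifting to formal sums\<close>

lemma fold_comp_replicate_idempotent:
  assumes "\<mu> (replicate n z) = z" "1 \<le> n"
  shows "fold_comp n \<mu> l (replicate (l * (n - 1) + 1) z) = z"
proof (induction l)
  case (Suc l)
  have "drop n (replicate (Suc l * (n - 1) + 1) z) = replicate (l * (n - 1)) z"
    and "take n (replicate (Suc l * (n - 1) + 1) z) = replicate n z"
    using \<open>1 \<le> n\<close> by simp_all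
  then show ?case using Suc assms(1) by (simp del: take_replicate drop_replicate)
qed simp

lemma polyadic_zero_idempotent:
  assumes "polyadic_zero m n R \<nu> \<mu> z" "1 \<le> m"
  shows "\<nu> (replicate m z) = z"
proof -
  have "replicate m z = z # replicate (m - 1) z"
    using assms(2) by (simp flip: replicate_Suc)
  then show ?thesis using assms(1) by (auto simp: polyadic_zero_def)
qed

lemma group_ring_add_closed:
  assumes sg: "nary_semigroup m R \<nu>" and M: "M = l * (m - 1) + 1"
    and ss: "ss \<in> tuples M (formal_sums m n R \<nu> \<mu> G)"
  shows "group_ring_add m \<nu> l G ss \<in> formal_sums m n R \<nu> \<mu> G"
proof -
  let ?t = "group_ring_add m \<nu> l G ss"
  have m: "1 \<le> m" using sg by (simp add: nary_semigroup_def)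
  have len: "length ss = M" and S: "set ss \<subseteq> formal_sums m n R \<nu> \<mu> G"
    using ss by (auto simp: tuples_def)
  have "?t \<in> G \<rightarrow>\<^sub>E R"
    unfolding group_ring_add_def
    by (rule restrict_PiE_iff[THEN iffD2], intro ballI fold_comp_closed[OF sg])
       (use S len M in \<open>auto simp: formal_sums_def\<close>)
  moreover have "finite {g \<in> G. ?t g \<noteq> z}" if z: "polyadic_zero m n R \<nu> \<mu> z" for z
  proof (rule finite_subset)
    show "{g \<in> G. ?t g \<noteq> z} \<subseteq> (\<Union>s\<in>set ss. {g \<in> G. s g \<noteq> z})"
    proof (rule subsetI, rule ccontr)
      fix g assume g: "g \<in> {g \<in> G. ?t g \<noteq> z}" "g \<notin> (\<Union>s\<in>set ss. {g \<in> G. s g \<noteq> z})"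
      then have "map (\<lambda>s. s g) ss = replicate M z"
        using len by (auto intro!: replicate_eqI)
      then have "?t g = z"
        using g fold_comp_replicate_idempotent[where \<mu> = \<nu> and n = m and z = z and l = l]
          polyadic_zero_idempotent[OF z m] m
        by (simp add: group_ring_add_def M)
      then show False using g by simp
    qed
    show "finite (\<Union>s\<in>set ss. {g \<in> G. s g \<noteq> z})"
      using S z by (auto simp: formal_sums_def)
  qed
  ultimately show ?thesis by (simp add: formal_sums_def)
qed

text \<open>Evaluation at \<open>g\<close> is a homomorphism from formal sums to \<open>R\<close>, so it commutes with placing an
  inner sum among the arguments of an outer one.\<close>

lemma insert_op_group_ring_add:
  assumes "g \<in> G"
  shows "insert_op M (group_ring_add m \<nu> l G) i ss g
       = insert_op M (fold_comp m \<nu> l) i (map (\<lambda>s. s g) ss)"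
  using assms by (simp add: insert_op_def group_ring_add_def take_map drop_map)

lemma group_ring_add_totally_associative:
  assumes sg: "nary_semigroup m R \<nu>" and M: "M = l * (m - 1) + 1"
  shows "totally_associative M (formal_sums m n R \<nu> \<mu> G) (group_ring_add m \<nu> l G)"
  unfolding totally_associative_def
proof (intro ballI allI impI)
  fix ss i j
  assume ss: "ss \<in> tuples (2 * M - 1) (formal_sums m n R \<nu> \<mu> G)" and ij: "i < M" "j < M"
  show "insert_op M (group_ring_add m \<nu> l G) i ss = insert_op M (group_ring_add m \<nu> l G) j ss"
  proof
    fix g
    show "insert_op M (group_ring_add m \<nu> l G) i ss g
        = insert_op M (group_ring_add m \<nu> l G) j ss g"
    proof (cases "g \<in> G")
      case True
      then have "map (\<lambda>s. s g) ss \<in> tuples (2 * M - 1) R"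
        using ss by (auto simp: tuples_def formal_sums_def)
      then show ?thesis
        using fold_comp_totally_associative[OF sg M] ij
        unfolding insert_op_group_ring_add[OF True] totally_associative_def by blast
    next
      case False
      \<comment> \<open>Off \<open>G\<close> both sides have the default value of an extensional function.\<close>
      then show ?thesis by (simp add: insert_op_def group_ring_add_def)
    qed
  qed
qed

theorem proposition5p1:
  fixes R :: "'r set" and \<nu> \<mu> :: "'r list \<Rightarrow> 'r"
    and G :: "'g set" and \<mu>G :: "'g list \<Rightarrow> 'g"
    and m\<^sub>r n\<^sub>r n\<^sub>g l\<^sub>m M :: nat
  assumes "polyadic_ring m\<^sub>r n\<^sub>r R \<nu> \<mu>"
    and "totally_associative m\<^sub>r R \<nu>"
    and "nary_group n\<^sub>g G \<mu>G"
    and "(\<nexists>z. polyadic_zero m\<^sub>r n\<^sub>r R \<nu> \<mu> z) \<Longrightarrow> finite G"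
    and "l\<^sub>m > 1"
    and "M = l\<^sub>m * (m\<^sub>r - 1) + 1"
    and "M > m\<^sub>r"
  shows "nary_operation M (formal_sums m\<^sub>r n\<^sub>r R \<nu> \<mu> G) (group_ring_add m\<^sub>r \<nu> l\<^sub>m G) \<and>
         totally_associative M (formal_sums m\<^sub>r n\<^sub>r R \<nu> \<mu> G) (group_ring_add m\<^sub>r \<nu> l\<^sub>m G)"
proof -
  note M = assms(6)
  have sg: "nary_semigroup m\<^sub>r R \<nu>"
    using assms(1) by (simp add: polyadic_ring_def nary_group_def)
  show ?thesis
    unfolding nary_operation_def
    by (intro conjI funcsetI group_ring_add_closed[OF sg M]
        group_ring_add_totally_associative[OF sg M])
qed

end
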